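(* Suppose the $n$ agents' valuations are drawn i.i.d. from a distribution on $[0,1]$ whose density $f$ is positive and Lipschitz continuous on $[0,1]$. When the number of agents approaches infinity, the optimal single deadline mechanism is optimal among all mechanisms in terms of expected sum-delay. That is, let $\mathrm{OPT}_n$ be the infimum of the expected sum-delay $E[\sum_{i=1}^n t_i]$ over all strategy-proof, individually rational and ex post budget balanced mechanisms for $n$ agents, and let $\mathrm{SD}_n$ be the infimum of the expected sum-delay over the single deadline mechanisms $M(d)$, $d\in[0,1]$. Then $$\lim_{n\to\infty}\bigl(\mathrm{SD}_n-\mathrm{OPT}_n\bigr)=0 .$$
   Context: Model. There are $n$ agents and a binary public project of cost $1$ that has value over the time period $[0,1]$. Agent $i$ has private valuation $v_i\in[0,1]$. A (deterministic, measurable) mechanism maps each reported profile in $[0,1]^n$ to a decision whether to build the project, release times $t_i\in[0,1]$ (agent $i$ consumes the project during $[t_i,1]$) and payments $p_i\ge0$. Agent $i$'s utility is $v_i(1-t_i)-p_i$. Expectations are over the valuations under truthful reporting. Strategy-proof: reporting the true $v_i$ maximizes agent $i$'s utility whatever the others report. Individually rational: a truthful agent's utility $v_i(1-t_i)-p_i$ is always nonnegative. Ex post budget balanced: if the project is not built, then $t_i=1$ and $p_i=0$ for all $i$; if it is built, then $\sum_i p_i=1$. For a vector $x=(x_1,\dots,x_m)$ of nonnegative reals, let $I(x)=1$ if there is $k\in\{1,\dots,m\}$ such that at least $k$ of the entries satisfy $x_j\ge \frac1k$, and $I(x)=0$ otherwise (in particular $I=0$ for the empty vector). If $I(x)=1$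 let $K(x)$ be the largest such $k$; if $I(x)=0$ let $K(x)=0$. Single deadline mechanism $M(d)$, $d\in[0,1]$: given the profile $v=(v_1,\dots,v_n)$, let $dv=(dv_1,\dots,dv_n)$ and let $v_{-i}$ be $v$ with the $i$-th entry removed. Let $k=K(dv)$. The project is built if and only if $k>0$. If $k>0$, the agents with the $k$ highest values receive the non-free part and each pays $\frac1k$; all other agents pay $0$. If $k=0$, no agent receives the non-free part and nobody pays. Agent $i$ receives the free part if and only if $I(dv_{-i})=1$. Agent $i$'s release time is $t_i=0$ if she receives both parts, $t_i=d$ if she receives only the free part, $t_i=1-d$ if she receives only the non-free part, and $t_i=1$ if she receives neither. *)

theory Defs
  imports "HOL-Analysis.Analysis"
begin

text \<open>
  Agents are the natural numbers below n. A profile is an (extensional) function from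
  agents to valuations in [0,1], so the profiles for n agents are exactly the space of the
  product measures used below. The components of a mechanism matter only on profiles and
  only for agents below n.
\<close>

definition profiles :: "nat \<Rightarrow> (nat \<Rightarrow> real) set" where
  "profiles n = ({..<n} \<rightarrow>\<^sub>E {0..1})"

definition profile_algebra :: "nat \<Rightarrow> (nat \<Rightarrow> real) measure" where
  "profile_algebra n = (\<Pi>\<^sub>M i\<in>{..<n}. restrict_space borel {0..1})"

record mechanism =
  built :: "(nat \<Rightarrow> real) \<Rightarrow> bool"
  release :: "(nat \<Rightarrow> real) \<Rightarrow> nat \<Rightarrow> real"
  payment :: "(nat \<Rightarrow> real) \<Rightarrow> nat \<Rightarrow> real"

definition is_mechanism :: "nat \<Rightarrow> mechanism \<Rightarrow> bool" where
  "is_mechanism n m \<longleftrightarrow>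
     Measurable.pred (profile_algebra n) (built m) \<and>
     (\<forall>i<n. (\<lambda>v. release m v i) \<in> borel_measurable (profile_algebra n)) \<and>
     (\<forall>i<n. (\<lambda>v. payment m v i) \<in> borel_measurable (profile_algebra n)) \<and>
     (\<forall>v\<in>profiles n. \<forall>i<n. release m v i \<in> {0..1} \<and> payment m v i \<ge> 0)"

text \<open>Utility of agent i with true valuation x when the reported profile is v.\<close>

definition utility :: "mechanism \<Rightarrow> nat \<Rightarrow> real \<Rightarrow> (nat \<Rightarrow> real) \<Rightarrow> real" where
  "utility m i x v = x * (1 - release m v i) - payment m v i"

definition strategy_proof :: "nat \<Rightarrow> mechanism \<Rightarrow> bool" where
  "strategy_proof n m \<longleftrightarrow>
     (\<forall>v\<in>profiles n. \<forall>i<n. \<forall>b\<in>{0..1}. utility m i (v i) v \<ge> utility m i (v i) (v(i := b)))"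

definition individually_rational :: "nat \<Rightarrow> mechanism \<Rightarrow> bool" where
  "individually_rational n m \<longleftrightarrow> (\<forall>v\<in>profiles n. \<forall>i<n. utility m i (v i) v \<ge> 0)"

definition ex_post_budget_balanced :: "nat \<Rightarrow> mechanism \<Rightarrow> bool" where
  "ex_post_budget_balanced n m \<longleftrightarrow>
     (\<forall>v\<in>profiles n.
        if built m v then (\<Sum>i<n. payment m v i) = 1
        else (\<forall>i<n. release m v i = 1 \<and> payment m v i = 0))"

text \<open>
  A vector x is represented by its finite index set A together with the entries x j for
  j in A; removing an entry means removing its index from A.
\<close>

definition cs_feasible :: "nat set \<Rightarrow> (nat \<Rightarrow> real) \<Rightarrow> nat \<Rightarrow> bool" where
  "cs_feasible A x k \<longleftrightarrow> k \<in> {1..card A} \<and> card {j\<in>A. x j \<ge> 1 / real k} \<ge> k"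

definition cs_I :: "nat set \<Rightarrow> (nat \<Rightarrow> real) \<Rightarrow> bool" where
  "cs_I A x \<longleftrightarrow> (\<exists>k. cs_feasible A x k)"

definition cs_K :: "nat set \<Rightarrow> (nat \<Rightarrow> real) \<Rightarrow> nat" where
  "cs_K A x = (if cs_I A x then Max {k. cs_feasible A x k} else 0)"

text \<open>
  Agent i is among the agents with the K(dv) highest values iff fewer than K(dv) agents have
  a strictly higher value. Ties need no breaking: by maximality of K(dv), exactly
  K(dv) agents satisfy this (lemma \<open>card_gets_nonfree\<close>). Nobody satisfies it if K(dv) = 0.
\<close>

definition gets_nonfree :: "nat \<Rightarrow> real \<Rightarrow> (nat \<Rightarrow> real) \<Rightarrow> nat \<Rightarrow> bool" where
  "gets_nonfree n d v i \<longleftrightarrow> card {j\<in>{..<n}. v j > v i} < cs_K {..<n} (\<lambda>j. d * v j)"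

definition gets_free :: "nat \<Rightarrow> real \<Rightarrow> (nat \<Rightarrow> real) \<Rightarrow> nat \<Rightarrow> bool" where
  "gets_free n d v i \<longleftrightarrow> cs_I ({..<n} - {i}) (\<lambda>j. d * v j)"

definition single_deadline :: "nat \<Rightarrow> real \<Rightarrow> mechanism" where
  "single_deadline n d = \<lparr>
     built = (\<lambda>v. cs_K {..<n} (\<lambda>j. d * v j) > 0),
     release = (\<lambda>v i.
       if gets_free n d v i then (if gets_nonfree n d v i then 0 else d)
       else (if gets_nonfree n d v i then 1 - d else 1)),
     payment = (\<lambda>v i.
       if gets_nonfree n d v i then 1 / real (cs_K {..<n} (\<lambda>j. d * v j)) else 0) \<rparr>"

lemma finite_cs_feasible: "finite {k. cs_feasible A x k}"
  by (rule finite_subset[of _ "{1..card A}"]) (auto simp: cs_feasible_def)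

lemma cs_feasible_cs_K:
  assumes "cs_K A x > 0" shows "cs_feasible A x (cs_K A x)"
proof -
  have I: "cs_I A x" using assms by (auto simp: cs_K_def split: if_splits)
  then have "{k. cs_feasible A x k} \<noteq> {}" by (auto simp: cs_I_def)
  from Max_in[OF finite_cs_feasible this] I show ?thesis by (simp add: cs_K_def)
qed

lemma cs_K_ge:
  assumes "cs_feasible A x k" shows "k \<le> cs_K A x"
  using assms Max_ge[OF finite_cs_feasible] by (auto simp: cs_K_def cs_I_def)

lemma card_cs_K:
  assumes A: "finite A" and K: "cs_K A x > 0"
  shows "card {j\<in>A. x j \<ge> 1 / real (cs_K A x)} = cs_K A x"
proof (rule ccontr)
  let ?k = "cs_K A x" and ?S = "\<lambda>k. {j\<in>A. x j \<ge> 1 / real k}"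
  assume "card (?S ?k) \<noteq> ?k"
  with cs_feasible_cs_K[OF K] have *: "card (?S ?k) \<ge> Suc ?k" by (auto simp: cs_feasible_def)
  have "1 / real (Suc ?k) \<le> 1 / real ?k" using K by (simp add: frac_le)
  then have "?S ?k \<subseteq> ?S (Suc ?k)" by auto
  then have "card (?S ?k) \<le> card (?S (Suc ?k))" using A by (intro card_mono) auto
  moreover have "card (?S ?k) \<le> card A" using A by (intro card_mono) auto
  ultimately have "cs_feasible A x (Suc ?k)" using * by (auto simp: cs_feasible_def)
  from cs_K_ge[OF this] show False by simp
qed

lemma gets_nonfree_iff:
  assumes d: "d \<ge> 0" and K: "cs_K {..<n} (\<lambda>j. d * v j) > 0" and i: "i < n"
  shows "gets_nonfree n d v i \<longleftrightarrow> d * v i \<ge> 1 / real (cs_K {..<n} (\<lambda>j. d * v j))"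
proof -
  define k where "k = cs_K {..<n} (\<lambda>j. d * v j)"
  let ?S = "{j\<in>{..<n}. d * v j \<ge> 1 / real k}"
  have S: "card ?S = k" using card_cs_K[OF _ K] by (simp add: k_def)
  have "k > 0" using K by (simp add: k_def)
  then have pos: "1 / real k > 0" by simp
  show ?thesis
  proof (cases "d * v i \<ge> 1 / real k")
    case True
    have "{j\<in>{..<n}. v j > v i} \<subset> ?S"
    proof
      show "{j\<in>{..<n}. v j > v i} \<subseteq> ?S"
        using True d by (auto intro: order_trans[OF _ mult_left_mono])
      show "{j\<in>{..<n}. v j > v i} \<noteq> ?S" using True i by blast
    qed
    from psubset_card_mono[OF _ this] S have "card {j\<in>{..<n}. v j > v i} < k" by simp
    with True show ?thesis by (simp add: gets_nonfree_def k_def)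
  next
    case False
    have "v j > v i" if "d * v j \<ge> 1 / real k" for j
    proof (rule ccontr)
      assume "\<not> v j > v i"
      then have "d * v j \<le> d * v i" using d by (simp add: mult_left_mono)
      with that False show False by linarith
    qed
    then have "?S \<subseteq> {j\<in>{..<n}. v j > v i}" by auto
    then have "k \<le> card {j\<in>{..<n}. v j > v i}"
      using S card_mono[of "{j\<in>{..<n}. v j > v i}" ?S] by simp
    with False show ?thesis by (simp add: gets_nonfree_def k_def)
  qed
qed

lemma card_gets_nonfree:
  assumes "d \<ge> 0"
  shows "card {i\<in>{..<n}. gets_nonfree n d v i} = cs_K {..<n} (\<lambda>j. d * v j)"
proof (cases "cs_K {..<n} (\<lambda>j. d * v j) > 0")
  case True
  have "{i\<in>{..<n}. gets_nonfree n d v i} =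
      {i\<in>{..<n}. d * v i \<ge> 1 / real (cs_K {..<n} (\<lambda>j. d * v j))}"
    using gets_nonfree_iff[OF assms True] by auto
  with card_cs_K[OF _ True] show ?thesis by simp
qed (simp add: gets_nonfree_def)

text \<open>Law of n i.i.d. valuations with density f on [0,1].\<close>

definition valuation_law :: "(real \<Rightarrow> real) \<Rightarrow> nat \<Rightarrow> (nat \<Rightarrow> real) measure" where
  "valuation_law f n =
     (\<Pi>\<^sub>M i\<in>{..<n}. density (restrict_space lborel {0..1}) (\<lambda>x. ennreal (f x)))"

definition expected_sum_delay :: "(real \<Rightarrow> real) \<Rightarrow> nat \<Rightarrow> mechanism \<Rightarrow> real" where
  "expected_sum_delay f n m = (\<integral>v. (\<Sum>i<n. release m v i) \<partial>valuation_law f n)"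

definition OPT :: "(real \<Rightarrow> real) \<Rightarrow> nat \<Rightarrow> real" where
  "OPT f n = (INF m \<in> {m. is_mechanism n m \<and> strategy_proof n m \<and>
     individually_rational n m \<and> ex_post_budget_balanced n m}. expected_sum_delay f n m)"

definition SD :: "(real \<Rightarrow> real) \<Rightarrow> nat \<Rightarrow> real" where
  "SD f n = (INF d \<in> {0..1}. expected_sum_delay f n (single_deadline n d))"

end

theory Submission
  imports Defs "HOL-Probability.Probability" "HOL-Real_Asymp.Real_Asymp"
begin

text \<open>
  Both quantities converge to the infimum \<open>h\<close> of \<open>F t / (t * (1 - F t))\<close> over \<open>0 < t < 1\<close>, where
  \<open>F\<close> is the distribution function of a valuation.

  Lower bound: against fixed reports of the others, a strategy-proof and individually rational
  mechanism is a mixture of posted prices \<open>t\<close> for a single agent. A price \<open>t\<close> costs expected delay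
  \<open>F t\<close> and raises \<open>t * (1 - F t)\<close>, so each agent's expected delay is at least \<open>h\<close> times her expected
  payment. The payments sum to the indicator of the project being built, while not building it
  costs delay \<open>n\<close>; hence the expected sum-delay is at least \<open>n * h / (n + h)\<close>.

  Upper bound: choose \<open>t\<close> almost attaining \<open>h\<close>, let \<open>s\<close> be slightly below \<open>1 - F t\<close>, and take the
  deadline \<open>d = 1 / (t * s * n)\<close>. By Hoeffding's inequality, up to exponentially small probability
  more than \<open>s * n + 1\<close> agents have value at least \<open>t\<close>. These all get the non-free part, everybody
  gets the free part, and the sum-delay is at most \<open>d\<close> times the number of agents with value below \<open>t\<close>.
\<close>

section \<open>Single deadline mechanisms\<close>

text \<open>The entries are compared only at the threshold \<open>1 / real k\<close>. This covers
  both adding agents and an agent who changes her report, up or down, while still clearing the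
  threshold.\<close>

lemma cs_feasible_mono:
  assumes "cs_feasible A x k" "A \<subseteq> B" "finite B" "\<And>j. j \<in> A \<Longrightarrow> x j \<ge> 1 / real k \<Longrightarrow> y j \<ge> 1 / real k"
  shows "cs_feasible B y k"
proof -
  have "card A \<le> card B" using assms by (intro card_mono) auto
  moreover have "card {j\<in>A. x j \<ge> 1 / real k} \<le> card {j\<in>B. y j \<ge> 1 / real k}"
    using assms by (intro card_mono) auto
  ultimately show ?thesis using assms(1) by (auto simp: cs_feasible_def)
qed

lemma cs_K_pos_iff: "cs_K A x > 0 \<longleftrightarrow> cs_I A x"
proof
  assume "cs_I A x"
  then obtain k where "cs_feasible A x k" by (auto simp: cs_I_def)
  then show "cs_K A x > 0" using cs_K_ge by (fastforce simp: cs_feasible_def)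
qed (auto simp: cs_K_def split: if_splits)

section \<open>Incentives, participation and budget of single deadline mechanisms\<close>

lemma gets_nonfree_imp_K_pos: "gets_nonfree n d v i \<Longrightarrow> cs_K {..<n} (\<lambda>j. d * v j) > 0"
  by (auto simp: gets_nonfree_def)

lemma gets_free_imp_K_pos:
  assumes "gets_free n d v i" shows "cs_K {..<n} (\<lambda>j. d * v j) > 0"
proof -
  obtain k where "cs_feasible ({..<n} - {i}) (\<lambda>j. d * v j) k"
    using assms by (auto simp: gets_free_def cs_I_def)
  then have "cs_feasible {..<n} (\<lambda>j. d * v j) k" by (rule cs_feasible_mono) auto
  then show ?thesis by (auto simp: cs_K_pos_iff cs_I_def)
qed

text \<open>The two parts are consumed for lengths \<open>1 - d\<close> and \<open>d\<close>, which
  add up to the whole period, so the utility splits. Whether the first summand is received does not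
  depend on the agent's own report, so incentives concern only the second.\<close>

lemma utility_single_deadline:
  "utility (single_deadline n d) i x v =
     of_bool (gets_free n d v i) * (x * (1 - d)) +
     of_bool (gets_nonfree n d v i) * (d * x - 1 / real (cs_K {..<n} (\<lambda>j. d * v j)))"
  by (auto simp: utility_def single_deadline_def algebra_simps)

lemma gets_free_upd [simp]: "gets_free n d (v(i := b)) i = gets_free n d v i"
proof -
  have "{j\<in>{..<n} - {i}. c \<le> d * (v(i := b)) j} = {j\<in>{..<n} - {i}. c \<le> d * v j}" for c
    by auto
  then show ?thesis by (simp only: gets_free_def cs_I_def cs_feasible_def)
qed

lemma nonfree_surplus_nonneg:
  assumes "d \<ge> 0" "i < n"
  shows "of_bool (gets_nonfree n d v i) * (d * v i - 1 / real (cs_K {..<n} (\<lambda>j. d * v j))) \<ge> 0"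
  using gets_nonfree_iff[OF assms(1) gets_nonfree_imp_K_pos assms(2)] by auto

text \<open>Suppose a deviation wins at a share that the true value also covers. Then the same
  coalition size stays feasible under the truthful report, so the truthful share is no larger. Any
  other deviation yields no positive surplus, while truth never yields a negative one.\<close>

lemma nonfree_surplus_strategy_proof:
  fixes d b :: real and v :: "nat \<Rightarrow> real"
  assumes d: "d \<ge> 0" and i: "i < n"
  defines "K \<equiv> \<lambda>v. cs_K {..<n} (\<lambda>j. d * v j)"
  defines "v' \<equiv> v(i := b)"
  shows "of_bool (gets_nonfree n d v' i) * (d * v i - 1 / real (K v'))
     \<le> of_bool (gets_nonfree n d v i) * (d * v i - 1 / real (K v))"
proof (cases "gets_nonfree n d v' i \<and> d * v i \<ge> 1 / real (K v')")
  case True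
  have pos: "K v' > 0" using True gets_nonfree_imp_K_pos by (auto simp: K_def)
  from cs_feasible_cs_K[of "{..<n}"] pos have "cs_feasible {..<n} (\<lambda>j. d * v' j) (K v')" by (simp add: K_def)
  then have feas: "cs_feasible {..<n} (\<lambda>j. d * v j) (K v')"
    by (rule cs_feasible_mono) (use True in \<open>auto simp: v'_def split: if_splits\<close>)
  then have "K v' \<le> K v" unfolding K_def by (rule cs_K_ge)
  then have le: "1 / real (K v) \<le> 1 / real (K v')" using pos by (simp add: frac_le)
  have "K v > 0" using pos \<open>K v' \<le> K v\<close> by simp
  then have "gets_nonfree n d v i" using gets_nonfree_iff[OF d _ i] True le by (auto simp: K_def)
  with True le show ?thesis by simp
next
  case False
  then have "of_bool (gets_nonfree n d v' i) * (d * v i - 1 / real (K v')) \<le> 0" by auto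
  also have "0 \<le> of_bool (gets_nonfree n d v i) * (d * v i - 1 / real (K v))"
    using nonfree_surplus_nonneg[OF d i] by (simp add: K_def)
  finally show ?thesis .
qed

lemma strategy_proof_single_deadline: "d \<in> {0..1} \<Longrightarrow> strategy_proof n (single_deadline n d)"
  using nonfree_surplus_strategy_proof[of d]
  by (auto simp: strategy_proof_def utility_single_deadline)

lemma individually_rational_single_deadline: "d \<in> {0..1} \<Longrightarrow> individually_rational n (single_deadline n d)"
  using nonfree_surplus_nonneg[of d]
  by (auto simp: individually_rational_def utility_single_deadline profiles_def PiE_iff intro!: add_nonneg_nonneg)

lemma ex_post_budget_balanced_single_deadline:
  assumes "d \<in> {0..1}" shows "ex_post_budget_balanced n (single_deadline n d)"
  unfolding ex_post_budget_balanced_def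
proof (intro ballI)
  fix v
  let ?K = "cs_K {..<n} (\<lambda>j. d * v j)"
  have "(\<Sum>i<n. payment (single_deadline n d) v i) = real (card {i\<in>{..<n}. gets_nonfree n d v i}) / real ?K"
    by (simp add: single_deadline_def sum.If_cases Int_def)
  also have "\<dots> = real ?K / real ?K" using card_gets_nonfree[of d n v] assms by simp
  finally have pay: "(\<Sum>i<n. payment (single_deadline n d) v i) = real ?K / real ?K" .
  show "if built (single_deadline n d) v then (\<Sum>i<n. payment (single_deadline n d) v i) = 1
        else (\<forall>i<n. release (single_deadline n d) v i = 1 \<and> payment (single_deadline n d) v i = 0)"
  proof (cases "?K > 0")
    case True
    with pay show ?thesis by (simp add: single_deadline_def)
  next
    case False
    then have "\<not> gets_nonfree n d v i" "\<not> gets_free n d v i" for i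
      using gets_nonfree_imp_K_pos[of n d v i] gets_free_imp_K_pos[of n d v i] by auto
    with False show ?thesis by (simp add: single_deadline_def)
  qed
qed

section \<open>Measurability of single deadline mechanisms\<close>

lemma measurable_coordinate: "i < n \<Longrightarrow> (\<lambda>v. v i) \<in> borel_measurable (profile_algebra n)"
proof -
  assume "i < n"
  have "(\<lambda>v. v i) \<in> measurable (profile_algebra n) (restrict_space borel {0..1})"
    unfolding profile_algebra_def using \<open>i < n\<close> by (intro measurable_component_singleton) auto
  then show ?thesis by (rule measurable_compose) (simp add: measurable_restrict_space1)
qed

lemma measurable_card_Collect:
  assumes "finite A" "\<And>j. j \<in> A \<Longrightarrow> Measurable.pred M (P j)"
  shows "(\<lambda>v. card {j\<in>A. P j v}) \<in> measurable M (count_space UNIV)"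
proof -
  have "card {j\<in>A. P j v} = (\<Sum>j\<in>A. if P j v then 1 else 0)" for v
    using assms(1) by (simp add: sum.If_cases Int_def)
  moreover have "(\<lambda>v. \<Sum>j\<in>A. if P j v then 1 else (0::nat)) \<in> measurable M (count_space UNIV)"
    using assms by (intro measurable_sum_nat measurable_If) auto
  ultimately show ?thesis by simp
qed

lemma pred_cs_feasible:
  assumes "A \<subseteq> {..<n}" shows "Measurable.pred (profile_algebra n) (\<lambda>v. cs_feasible A (\<lambda>j. d * v j) k)"
proof -
  have [measurable]: "(\<lambda>v. card {j\<in>A. d * v j \<ge> 1 / real k}) \<in> measurable (profile_algebra n) (count_space UNIV)"
  proof (rule measurable_card_Collect)
    fix j assume "j \<in> A"
    then have [measurable]: "(\<lambda>v. v j) \<in> borel_measurable (profile_algebra n)"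
      using assms by (intro measurable_coordinate) auto
    show "Measurable.pred (profile_algebra n) (\<lambda>v. d * v j \<ge> 1 / real k)" by measurable
  qed (use assms finite_subset in blast)
  show ?thesis unfolding cs_feasible_def by measurable
qed

lemma pred_gets_free: "Measurable.pred (profile_algebra n) (\<lambda>v. gets_free n d v i)"
proof -
  note [measurable] = pred_cs_feasible[of "{..<n} - {i}" n d, OF Diff_subset]
  show ?thesis unfolding gets_free_def cs_I_def by measurable
qed

text \<open>This replaces the maximum in \<open>cs_K\<close> by a countable union of feasibility
  events, which are measurable.\<close>

lemma less_cs_K_iff: "c < cs_K A x \<longleftrightarrow> (\<exists>k. cs_feasible A x k \<and> c < k)"
  using cs_feasible_cs_K[of A x] cs_K_ge[of A x] by (auto intro: less_le_trans)

lemma pred_gets_nonfree: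
  assumes "i < n" shows "Measurable.pred (profile_algebra n) (\<lambda>v. gets_nonfree n d v i)"
proof -
  note [measurable] = pred_cs_feasible[of "{..<n}" n d, OF order_refl]
  have [measurable]: "(\<lambda>v. card {j\<in>{..<n}. v j > v i}) \<in> measurable (profile_algebra n) (count_space UNIV)"
  proof (rule measurable_card_Collect)
    fix j assume "j \<in> {..<n}"
    then have [measurable]: "(\<lambda>v. v j) \<in> borel_measurable (profile_algebra n)"
       "(\<lambda>v. v i) \<in> borel_measurable (profile_algebra n)"
      using assms by (auto intro: measurable_coordinate)
    show "Measurable.pred (profile_algebra n) (\<lambda>v. v j > v i)" by measurable
  qed auto
  show ?thesis unfolding gets_nonfree_def less_cs_K_iff by measurable
qed

lemma measurable_cs_K:
  assumes "d \<ge> 0"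
  shows "(\<lambda>v. cs_K {..<n} (\<lambda>j. d * v j)) \<in> measurable (profile_algebra n) (count_space UNIV)"
  \<comment> \<open>The coalition size equals the number of winners, hence a finite sum of
    measurable indicators.\<close>
  unfolding card_gets_nonfree[OF assms, symmetric]
  by (rule measurable_card_Collect) (auto intro: pred_gets_nonfree)

lemma is_mechanism_single_deadline:
  assumes "d \<in> {0..1}" shows "is_mechanism n (single_deadline n d)"
proof -
  have [measurable]: "(\<lambda>v. cs_K {..<n} (\<lambda>j. d * v j)) \<in> measurable (profile_algebra n) (count_space UNIV)"
    using assms by (intro measurable_cs_K) auto
  note [measurable] = pred_gets_free pred_gets_nonfree
  show ?thesis unfolding is_mechanism_def
  proof (intro conjI allI impI)
    fix i assume [measurable]: "i < n"
    show "(\<lambda>v. release (single_deadline n d) v i) \<in> borel_measurable (profile_algebra n)"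
      "(\<lambda>v. payment (single_deadline n d) v i) \<in> borel_measurable (profile_algebra n)"
      unfolding single_deadline_def mechanism.simps by measurable
  next
    show "Measurable.pred (profile_algebra n) (built (single_deadline n d))"
      unfolding single_deadline_def mechanism.simps by measurable
  qed (use assms in \<open>auto simp: single_deadline_def\<close>)
qed

text \<open>Since \<open>d * \<theta> * a >= 1\<close>, any group of at least \<open>a\<close>
  agents with values at least \<theta> can afford equal shares. The \<open>+ 1\<close> pays for
  leaving out the agent whose free part is being decided. So everybody gets the free part, and only
  agents without the non-free part wait, each until \<open>d\<close>.\<close>

lemma sum_release_single_deadline_le:
  assumes d: "d \<in> {0..1}" and N: "real (card {i\<in>{..<n}. v i \<ge> \<theta>}) \<ge> a + 1" and a: "a \<ge> 1" "d * \<theta> * a \<ge> 1"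
  shows "(\<Sum>i<n. release (single_deadline n d) v i) \<le> d * (real n - real (card {i\<in>{..<n}. v i \<ge> \<theta>}))"
proof -
  let ?S = "{i\<in>{..<n}. v i \<ge> \<theta>}"
  let ?K = "cs_K {..<n} (\<lambda>j. d * v j)"
  have feasible: "cs_feasible A (\<lambda>j. d * v j) (card (?S \<inter> A))" if A: "A \<subseteq> {..<n}" "real (card (?S \<inter> A)) \<ge> a" for A
  proof -
    let ?k = "card (?S \<inter> A)"
    have k: "real ?k \<ge> 1" using a A by linarith
    have "finite A" using A finite_subset by blast
    have "1 \<le> d * \<theta> * real ?k"
    proof -
      have "d * \<theta> \<ge> 0" using a by (smt (verit) mult_nonneg_nonpos2 mult_nonneg_nonneg mult_le_0_iff)
      then have "d * \<theta> * a \<le> d * \<theta> * real ?k" using A by (intro mult_left_mono) auto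
      with a show ?thesis by simp
    qed
    then have "1 / real ?k \<le> d * \<theta>" using k by (simp add: field_simps)
    then have "?S \<inter> A \<subseteq> {j\<in>A. d * v j \<ge> 1 / real ?k}"
      using d by (auto intro: order_trans mult_left_mono)
    then have "?k \<le> card {j\<in>A. d * v j \<ge> 1 / real ?k}" using \<open>finite A\<close> by (intro card_mono) auto
    moreover have "?k \<le> card A" using \<open>finite A\<close> by (intro card_mono) auto
    ultimately show ?thesis using k by (auto simp: cs_feasible_def)
  qed
  \<comment> \<open>Without any one agent, at least \<open>a\<close> acceptors of the price \<open>\<theta>\<close> remain.\<close>
  have free: "gets_free n d v i" for i
  proof -
    have "card ?S \<le> Suc (card (?S \<inter> ({..<n} - {i})))"
    proof -
      have "card ?S \<le> card (insert i (?S \<inter> ({..<n} - {i})))" by (intro card_mono) auto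
      also have "\<dots> \<le> Suc (card (?S \<inter> ({..<n} - {i})))" by (simp add: card_insert_if)
      finally show ?thesis .
    qed
    then have "real (card (?S \<inter> ({..<n} - {i}))) \<ge> a" using N by linarith
    from feasible[OF _ this] show ?thesis by (auto simp: gets_free_def cs_I_def)
  qed
  have eq: "?S \<inter> {..<n} = ?S" by auto
  have "card ?S \<le> ?K" using feasible[OF order_refl] N by (intro cs_K_ge) (simp add: eq del: lessThan_iff)
  have "(\<Sum>i<n. release (single_deadline n d) v i) = (\<Sum>i<n. d - (if gets_nonfree n d v i then d else 0))"
    using free by (intro sum.cong) (auto simp: single_deadline_def)
  also have "\<dots> = d * real n - d * real (card {i\<in>{..<n}. gets_nonfree n d v i})"
    by (simp add: sum_subtractf sum.If_cases Int_def)
  also have "\<dots> = d * (real n - real ?K)" using card_gets_nonfree[of d n v] d by (simp add: algebra_simps)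
  also have "\<dots> \<le> d * (real n - real (card ?S))" using d \<open>card ?S \<le> ?K\<close> by (intro mult_left_mono) auto
  finally show ?thesis .
qed

section \<open>Delay and payment of a single agent\<close>

text \<open>Along a uniform grid with \<open>Suc N\<close> cells the errors telescope to
  \<open>m 1 - m 0\<close> times the mesh, which tends to 0. This stands in for a derivative
  argument where \<phi> may fail to be differentiable.\<close>

lemma le_if_increments_le_mult_increments:
  fixes \<phi> m :: "real \<Rightarrow> real"
  assumes inc: "\<And>w z. \<lbrakk>0 \<le> w; w \<le> z; z \<le> 1\<rbrakk> \<Longrightarrow> \<phi> z - \<phi> w \<le> (z - w) * (m z - m w)"
  shows "\<phi> 1 \<le> \<phi> 0"
proof -
  have bound: "\<phi> 1 - \<phi> 0 \<le> (m 1 - m 0) * inverse (real (Suc N))" for N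
  proof -
    define t where "t i = real i / real (Suc N)" for i
    have t: "t 0 = 0" "t (Suc N) = 1" by (auto simp: t_def)
    have step: "\<phi> (t (Suc i)) - \<phi> (t i) \<le> (m (t (Suc i)) - m (t i)) * inverse (real (Suc N))"
      if "i < Suc N" for i
    proof -
      have "\<phi> (t (Suc i)) - \<phi> (t i) \<le> (t (Suc i) - t i) * (m (t (Suc i)) - m (t i))"
        using that by (intro inc) (auto simp: t_def divide_simps)
      moreover have "t (Suc i) - t i = inverse (real (Suc N))"
        by (simp add: t_def field_simps)
      ultimately show ?thesis by (simp add: mult.commute)
    qed
    have "\<phi> 1 - \<phi> 0 = (\<Sum>i<Suc N. \<phi> (t (Suc i)) - \<phi> (t i))"
      by (subst sum_lessThan_telescope) (simp add: t)
    also have "\<dots> \<le> (\<Sum>i<Suc N. (m (t (Suc i)) - m (t i)) * inverse (real (Suc N)))"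
      using step by (intro sum_mono) auto
    also have "\<dots> = (\<Sum>i<Suc N. m (t (Suc i)) - m (t i)) * inverse (real (Suc N))"
      by (simp only: sum_distrib_right)
    also have "\<dots> = (m 1 - m 0) * inverse (real (Suc N))"
      by (subst sum_lessThan_telescope) (simp add: t)
    finally show ?thesis .
  qed
  have "(\<lambda>N. (m 1 - m 0) * inverse (real (Suc N))) \<longlonglongrightarrow> (m 1 - m 0) * 0"
    by (intro tendsto_mult tendsto_const LIMSEQ_inverse_real_of_nat)
  from LIMSEQ_le_const[OF this, of "\<phi> 1 - \<phi> 0"] bound show ?thesis by auto
qed

section \<open>The distribution function of a valuation\<close>

locale valuation_density =
  fixes f :: "real \<Rightarrow> real"
  assumes f_cont: "continuous_on {0..1} f"
    and f_pos: "\<And>x. x \<in> {0..1} \<Longrightarrow> f x > 0"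
    and f_total: "(f has_integral 1) {0..1}"
begin

definition F :: "real \<Rightarrow> real" where "F z = integral {0..z} f"

lemma f_integrable: "0 \<le> a \<Longrightarrow> b \<le> 1 \<Longrightarrow> f integrable_on {a..b}"
  by (rule integrable_continuous_interval[OF continuous_on_subset[OF f_cont]]) auto

lemma F_0 [simp]: "F 0 = 0" by (simp add: F_def)

lemma F_1 [simp]: "F 1 = 1" using f_total by (simp add: F_def integral_unique)

lemma F_diff: "0 \<le> w \<Longrightarrow> w \<le> z \<Longrightarrow> z \<le> 1 \<Longrightarrow> integral {w..z} f = F z - F w"
  using Henstock_Kurzweil_Integration.integral_combine[of 0 w z f] f_integrable by (simp add: F_def)

lemma F_mono: assumes "0 \<le> w" "w \<le> z" "z \<le> 1" shows "F w \<le> F z"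
proof -
  have "0 \<le> integral {w..z} f"
    using assms f_pos by (intro integral_nonneg f_integrable) (auto intro: less_imp_le)
  with F_diff assms show ?thesis by simp
qed

lemma F_strict_mono: assumes "0 \<le> w" "w < z" "z \<le> 1" shows "F w < F z"
proof -
  have "continuous_on {w..z} f" using f_cont by (rule continuous_on_subset) (use assms in auto)
  \<comment> \<open>The minimum of the continuous density over the interval is attained, hence
    positive, and bounds the increment of \<open>F\<close> from below.\<close>
  then obtain a where a: "a \<in> {w..z}" "\<And>y. y \<in> {w..z} \<Longrightarrow> f a \<le> f y"
    using continuous_attains_inf[of "{w..z}" f] assms by auto
  have "integral {w..z} (\<lambda>_. f a) \<le> integral {w..z} f"
    using assms a by (intro integral_le f_integrable) auto
  moreover have "0 < (z - w) * f a" using assms a(1) f_pos[of a] by simp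
  ultimately show ?thesis using F_diff[of w z] assms by simp
qed

lemma F_bounds: "z \<in> {0..1} \<Longrightarrow> 0 \<le> F z \<and> F z \<le> 1"
  using F_mono[of 0 z] F_mono[of z 1] by auto

lemma F_deriv: "z \<in> {0..1} \<Longrightarrow> (F has_real_derivative f z) (at z within {0..1})"
  unfolding F_def by (rule integral_has_real_derivative[OF f_cont])

lemma F_cont: "continuous_on {0..1} F"
  using F_deriv by (meson DERIV_continuous_on)

text \<open>Here \<open>x\<close> and \<open>p\<close> are one agent's consumption and payment as
  functions of her report. Integration by parts bounds the expected payment by the integral of
  \<open>x z * (z * f z - (1 - F z))\<close>. The resulting inequality is linear in the monotone
  function \<open>x\<close>, so it reduces to a single posted price, where it is the assumption on
  \<open>h\<close>. Neither \<open>x\<close> nor \<open>p\<close> is assumed measurable;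
  integrability follows from monotonicity.\<close>

lemma monopoly_bound:
  assumes x01: "\<And>z. z \<in> {0..1} \<Longrightarrow> 0 \<le> x z \<and> x z \<le> 1"
    and p0: "\<And>z. z \<in> {0..1} \<Longrightarrow> 0 \<le> p z"
    and sp: "\<And>z w. z \<in> {0..1} \<Longrightarrow> w \<in> {0..1} \<Longrightarrow> z * x w - p w \<le> z * x z - p z"
    and ir: "p 0 \<le> 0"
    and h: "\<And>t. t \<in> {0..1} \<Longrightarrow> h * (t * (1 - F t)) \<le> F t" and h0: "0 \<le> h"
  shows "h * integral {0..1} (\<lambda>z. f z * p z) \<le> integral {0..1} (\<lambda>z. f z * (1 - x z))"
    and "(\<lambda>z. f z * p z) integrable_on {0..1}"
    and "(\<lambda>z. f z * (1 - x z)) integrable_on {0..1}"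
proof -
  define U where "U z = z * x z - p z" for z
  \<comment> \<open>The value \<open>x w\<close> is a subgradient of \<open>U\<close> at
    \<open>w\<close>; exchanging \<open>z\<close> and \<open>w\<close> shows that \<open>x\<close>
    is monotone.\<close>
  have U_diff: "(z - w) * x w \<le> U z - U w" if "z \<in> {0..1}" "w \<in> {0..1}" for z w
    using sp[OF that] by (simp add: U_def algebra_simps)
  have x_mono: "x w \<le> x z" if "0 \<le> w" "w \<le> z" "z \<le> 1" for w z
  proof (cases "w = z")
    case False
    have "(z - w) * x w \<le> (z - w) * x z"
      using U_diff[of z w] U_diff[of w z] that by (simp add: algebra_simps)
    with False that show ?thesis by simp
  qed simp
  have U_mono: "U w \<le> U z" if "0 \<le> w" "w \<le> z" "z \<le> 1" for w z
  proof -
    have "0 \<le> (z - w) * x w" using that x01[of w] by auto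
    then show ?thesis using U_diff[of z w] that by simp
  qed
  have U0: "U 0 = 0" using ir p0[of 0] by (simp add: U_def)
  have U_nonneg: "0 \<le> U z" if "z \<in> {0..1}" for z using U_mono[of 0 z] U0 that by auto
  \<comment> \<open>The second mean value theorem also asserts integrability of the product of a
    monotone and a continuous function.\<close>
  have mult_integrable: "(\<lambda>z. g z * k z) integrable_on {a..b}"
    if ab: "0 \<le> a" "b \<le> 1" "a \<le> b"
    and k: "continuous_on {0..1} k" and g: "\<And>w z. 0 \<le> w \<Longrightarrow> w \<le> z \<Longrightarrow> z \<le> 1 \<Longrightarrow> g w \<le> g z"
    for a b and g k :: "real \<Rightarrow> real"
  proof -
    have "k integrable_on {a..b}"
      by (rule integrable_continuous_interval[OF continuous_on_subset[OF k]]) (use ab in auto)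
    then obtain c where "((\<lambda>z. g z * k z) has_integral (g a * integral {a..c} k + g b * integral {c..b} k)) {a..b}"
      using second_mean_value_theorem_full[of k a b g] g ab by (metis order_trans)
    then show ?thesis by blast
  qed
  have cF: "continuous_on {0..1} (\<lambda>z. 1 - F z)" by (intro continuous_intros F_cont)
  have int_xF: "(\<lambda>z. x z * (1 - F z)) integrable_on {a..b}" if "0 \<le> a" "a \<le> b" "b \<le> 1" for a b
    using mult_integrable[OF _ _ _ cF x_mono] that by simp
  have int_Uf: "(\<lambda>z. U z * f z) integrable_on {a..b}" if "0 \<le> a" "a \<le> b" "b \<le> 1" for a b
    using mult_integrable[OF _ _ _ f_cont U_mono] that by simp
  have int_xf: "(\<lambda>z. x z * f z) integrable_on {0..1}"
    using mult_integrable[OF _ _ _ f_cont x_mono] by simp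
  have int_xzf: "(\<lambda>z. x z * (z * f z)) integrable_on {0..1}"
    by (rule mult_integrable) (auto intro!: continuous_intros f_cont x_mono)
  \<comment> \<open>Integration by parts for the indirect utility \<open>U\<close>, which need not be differentiable: compare
    the increments of \<open>U z * (1 - F z)\<close> with those of the integral of its formal derivative.\<close>
  define A where "A z = integral {0..z} (\<lambda>z. x z * (1 - F z)) - integral {0..z} (\<lambda>z. U z * f z)" for z
  define W where "W z = U z * (1 - F z)" for z
  have "A 1 - W 1 \<le> A 0 - W 0"
  proof (rule le_if_increments_le_mult_increments[where m = "\<lambda>z. x z + F z" and \<phi> = "\<lambda>z. A z - W z"])
    fix w z :: real assume wz: "0 \<le> w" "w \<le> z" "z \<le> 1"
    have A: "A z - A w = integral {w..z} (\<lambda>z. x z * (1 - F z)) - integral {w..z} (\<lambda>z. U z * f z)"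
      using Henstock_Kurzweil_Integration.integral_combine[of 0 w z "\<lambda>z. x z * (1 - F z)"]
        Henstock_Kurzweil_Integration.integral_combine[of 0 w z "\<lambda>z. U z * f z"] wz int_xF[of 0 z] int_Uf[of 0 z]
      by (simp add: A_def)
    have "integral {w..z} (\<lambda>z. x z * (1 - F z)) \<le> integral {w..z} (\<lambda>_. x z * (1 - F w))"
      using wz x01 F_bounds by (intro integral_le int_xF mult_mono x_mono) (auto intro!: F_mono)
    then have 1: "integral {w..z} (\<lambda>z. x z * (1 - F z)) \<le> (z - w) * (x z * (1 - F w))"
      using wz by (simp add: mult.left_commute)
    have "integral {w..z} (\<lambda>y. U w * f y) \<le> integral {w..z} (\<lambda>z. U z * f z)"
      using wz f_pos
      by (intro integral_le int_Uf mult_right_mono U_mono integrable_on_mult_right f_integrable)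
         (auto intro: less_imp_le)
    then have 2: "U w * (F z - F w) \<le> integral {w..z} (\<lambda>z. U z * f z)"
      using wz F_diff by simp
    have "(z - w) * x w * (1 - F z) \<le> (U z - U w) * (1 - F z)"
      using U_diff[of z w] wz F_bounds[of z] by (intro mult_right_mono) auto
    then have 3: "(z - w) * x w * (1 - F z) - U w * (F z - F w) \<le> W z - W w"
      by (simp add: W_def algebra_simps)
    \<comment> \<open>After the terms \<open>U w * (F z - F w)\<close> cancel, this is the gap left
      between the bounds on the increments of \<open>A\<close> and \<open>W\<close>. Its
      coefficients lie in [0,1], so the increment of \<open>x + F\<close> dominates it.\<close>
    have "x z * (1 - F w) - x w * (1 - F z) = (x z - x w) * (1 - F z) + x z * (F z - F w)"
      by (simp add: algebra_simps)
    also have "\<dots> \<le> (x z - x w) * 1 + 1 * (F z - F w)"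
      using wz x_mono[OF wz] F_mono[OF wz] x01 F_bounds by (intro add_mono mult_left_mono mult_right_mono) auto
    finally have "(z - w) * (x z * (1 - F w) - x w * (1 - F z)) \<le> (z - w) * (x z + F z - (x w + F w))"
      using wz by (intro mult_left_mono) auto
    with A 1 2 3 show "A z - W z - (A w - W w) \<le> (z - w) * (x z + F z - (x w + F w))"
      by (simp add: algebra_simps)
  qed
  \<comment> \<open>The boundary terms vanish because \<open>U 0 = 0\<close> and
    \<open>F 1 = 1\<close>. As \<open>p z = z * x z - U z\<close>, this bounds the expected payment
    from above.\<close>
  then have envelope: "integral {0..1} (\<lambda>z. x z * (1 - F z)) \<le> integral {0..1} (\<lambda>z. U z * f z)"
    by (simp add: A_def W_def U0)
  \<comment> \<open>What remains is \<open>\<integral> x * G' \<le> 1\<close> for a monotone \<open>x\<close>, where \<open>G \<ge> 0\<close>, \<open>G 0 = 0\<close> and \<open>G 1 = 1\<close>.\<close>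
  define G where "G t = F t - h * (t * (1 - F t))" for t
  define g where "g t = f t + h * (t * f t - (1 - F t))" for t
  have G_deriv: "(G has_real_derivative g t) (at t within {0..1})" if "t \<in> {0..1}" for t
    unfolding G_def[abs_def] g_def
    by (rule derivative_eq_intros F_deriv[OF that] refl)+ (simp add: algebra_simps)
  have g_int: "(g has_integral (G b - G a)) {a..b}" if "0 \<le> a" "a \<le> b" "b \<le> 1" for a b
  proof (rule fundamental_theorem_of_calculus[OF that(2)])
    fix t assume "t \<in> {a..b}"
    then show "(G has_vector_derivative g t) (at t within {a..b})"
      using G_deriv[of t] that
      by (auto simp: has_real_derivative_iff_has_vector_derivative[symmetric] intro: DERIV_subset)
  qed
  \<comment> \<open>The mean value theorem replaces \<open>x\<close> by a step function jumping from
    \<open>x 0\<close> to \<open>x 1\<close> at \<open>c\<close>. Thus \<open>c\<close> acts as a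
    posted price, and \<open>G c >= 0\<close> is the assumption on \<open>h\<close> at that
    price.\<close>
  obtain c where c: "c \<in> {0..1}" "((\<lambda>z. x z * g z) has_integral
      (x 0 * integral {0..c} g + x 1 * integral {c..1} g)) {0..1}"
    using second_mean_value_theorem_full[of g 0 1 x] g_int[of 0 1] x_mono by auto
  have Gc: "0 \<le> G c" using h[OF c(1)] by (simp add: G_def)
  have "integral {0..1} (\<lambda>z. x z * g z) = x 0 * G c + x 1 * (1 - G c)"
    using c integral_unique[OF g_int[of 0 c]] integral_unique[OF g_int[of c 1]]
      integral_unique[OF c(2)] by (simp add: G_def)
  also have "\<dots> = x 1 - (x 1 - x 0) * G c" by (simp add: algebra_simps)
  also have "\<dots> \<le> 1" using x01[of 1] Gc x_mono[of 0 1] by (smt (verit) mult_nonneg_nonneg atLeastAtMost_iff)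
  finally have le1: "integral {0..1} (\<lambda>z. x z * g z) \<le> 1" .
  have int_x1: "(\<lambda>z. x z * (1 - F z)) integrable_on {0..1}" and int_U1: "(\<lambda>z. U z * f z) integrable_on {0..1}"
    using int_xF int_Uf by auto
  note I = integrable_integral[OF int_x1] integrable_integral[OF int_U1]
    integrable_integral[OF int_xf] integrable_integral[OF int_xzf]
  have P: "((\<lambda>z. f z * p z) has_integral
      (integral {0..1} (\<lambda>z. x z * (z * f z)) - integral {0..1} (\<lambda>z. U z * f z))) {0..1}"
    using has_integral_diff[OF I(4) I(2)] by (simp add: U_def algebra_simps)
  have D: "((\<lambda>z. f z * (1 - x z)) has_integral (1 - integral {0..1} (\<lambda>z. x z * f z))) {0..1}"
    using has_integral_diff[OF f_total I(3)] by (simp add: algebra_simps)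
  have X: "((\<lambda>z. x z * g z) has_integral (integral {0..1} (\<lambda>z. x z * f z) + h *
       (integral {0..1} (\<lambda>z. x z * (z * f z)) - integral {0..1} (\<lambda>z. x z * (1 - F z))))) {0..1}"
    using has_integral_add[OF I(3) has_integral_mult_right[OF has_integral_diff[OF I(4) I(1)], of h]]
    by (simp add: g_def algebra_simps)
  have "h * (integral {0..1} (\<lambda>z. x z * (z * f z)) - integral {0..1} (\<lambda>z. U z * f z))
     \<le> h * (integral {0..1} (\<lambda>z. x z * (z * f z)) - integral {0..1} (\<lambda>z. x z * (1 - F z)))"
    using envelope h0 by (intro mult_left_mono) auto
  with le1 integral_unique[OF X] integral_unique[OF P] integral_unique[OF D]
  show "h * integral {0..1} (\<lambda>z. f z * p z) \<le> integral {0..1} (\<lambda>z. f z * (1 - x z))" by simp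
  show "(\<lambda>z. f z * p z) integrable_on {0..1}" "(\<lambda>z. f z * (1 - x z)) integrable_on {0..1}"
    using P D by blast+
qed

section \<open>Independent valuations\<close>

definition D :: "real measure" where
  "D = density (restrict_space lborel {0..1}) (\<lambda>x. ennreal (f x))"

lemma valuation_law_eq: "valuation_law f n = (\<Pi>\<^sub>M i\<in>{..<n}. D)"
  by (simp add: valuation_law_def D_def)

lemma space_D [simp]: "space D = {0..1}"
  by (simp add: D_def)

lemma sets_D: "sets D = sets (restrict_space borel {0..1})"
  by (simp add: D_def cong: sets_restrict_space_cong)

lemma measurable_ident_D [measurable]: "(\<lambda>x. x) \<in> borel_measurable D"
  by (simp add: measurable_cong_sets[OF sets_D refl] measurable_restrict_space1)

lemma f_measurable: "f \<in> borel_measurable (restrict_space lborel {0..1})"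
  using borel_measurable_continuous_on_restrict[OF f_cont]
  by (simp cong: measurable_cong_sets sets_restrict_space_cong)

text \<open>This passes from Lebesgue integrals against \<open>D\<close> to the gauge integrals of
  \<open>monopoly_bound\<close>; the bound \<open>B\<close> supplies integrability.\<close>

lemma integral_D:
  assumes g: "g \<in> borel_measurable D" and B: "\<And>x. x \<in> {0..1} \<Longrightarrow> \<bar>g x\<bar> \<le> B"
  shows "integral\<^sup>L D g = integral {0..1} (\<lambda>x. f x * g x)"
proof -
  let ?R = "restrict_space lborel {0..1::real}"
  interpret R: finite_measure ?R
    by (rule finite_measureI) (simp add: emeasure_restrict_space)
  have g': "g \<in> borel_measurable ?R" using g by (simp add: D_def)
  obtain C where C: "\<And>x. x \<in> {0..1} \<Longrightarrow> \<bar>f x\<bar> \<le> C"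
    using compact_imp_bounded[OF compact_continuous_image[OF f_cont compact_Icc]]
    by (fastforce simp: bounded_iff)
  have "integrable ?R (\<lambda>x. f x * g x)"
  proof (rule R.integrable_const_bound)
    show "AE x in ?R. norm (f x * g x) \<le> C * B"
      using B C by (intro AE_I2) (auto simp: abs_mult intro!: mult_mono' order_trans[OF abs_ge_zero])
  qed (use f_measurable g' in measurable)
  then have int: "set_integrable lborel {0..1} (\<lambda>x. f x * g x)"
    by (simp add: integrable_restrict_space set_integrable_def)
  have "integral\<^sup>L D g = integral\<^sup>L ?R (\<lambda>x. f x *\<^sub>R g x)"
    unfolding D_def using g' f_measurable f_pos by (intro integral_density AE_I2) (auto intro: less_imp_le)
  also have "\<dots> = (LINT x:{0..1}|lborel. f x * g x)"
    by (simp add: integral_restrict_space set_lebesgue_integral_def)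
  also have "\<dots> = integral {0..1} (\<lambda>x. f x * g x)"
    using set_borel_integral_eq_integral(2)[OF int] .
  finally show ?thesis .
qed

lemma prob_space_D: "prob_space D"
proof
  let ?R = "restrict_space lborel {0..1::real}"
  have int: "integrable lborel (\<lambda>x. indicator {0..1} x *\<^sub>R f x)"
    using borel_integrable_atLeastAtMost'[OF f_cont] by (simp add: set_integrable_def)
  then have intR: "integrable ?R f" by (simp add: integrable_restrict_space)
  have "integral\<^sup>L ?R f = (LINT x:{0..1}|lborel. f x)"
    by (simp add: integral_restrict_space set_lebesgue_integral_def)
  also have "\<dots> = 1"
    using set_borel_integral_eq_integral(2)[of "{0..1}" f] int f_total
    by (simp add: set_integrable_def integral_unique)
  finally have "integral\<^sup>L ?R f = 1" .
  moreover have "emeasure D (space D) = (\<integral>\<^sup>+x. ennreal (f x) \<partial>?R)"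
    using f_measurable unfolding space_D unfolding D_def
    by (subst emeasure_density) (auto intro!: nn_integral_cong simp: sets_restrict_space)
  moreover have "AE x in ?R. 0 \<le> f x" using f_pos by (intro AE_I2) (auto intro: less_imp_le)
  ultimately show "emeasure D (space D) = 1"
    using nn_integral_eq_integral[OF intR] by simp
qed

sublocale D: prob_space D by (rule prob_space_D)

lemma prob_space_valuation_law: "prob_space (valuation_law f n)"
  unfolding valuation_law_eq by (intro prob_space_PiM prob_space_D)

lemma space_valuation_law: "space (valuation_law f n) = profiles n"
  by (simp add: valuation_law_eq profiles_def space_PiM)

lemma sets_valuation_law: "sets (valuation_law f n) = sets (profile_algebra n)"
  unfolding valuation_law_eq profile_algebra_def by (intro sets_PiM_cong refl sets_D)

lemma measurable_valuation_law:
  "measurable (valuation_law f n) N = measurable (profile_algebra n) N"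
  by (rule measurable_cong_sets[OF sets_valuation_law refl])

section \<open>The number of agents accepting a posted price\<close>

lemma integral_tail:
  assumes "\<theta> \<in> {0..1}"
  shows "(\<integral>x. (if \<theta> \<le> x then 1 else 0) \<partial>D) = 1 - F \<theta>"
proof -
  have "(\<integral>x. (if \<theta> \<le> x then 1 else 0) \<partial>D) = integral {0..1} (\<lambda>x. f x * (if \<theta> \<le> x then 1 else 0))"
    by (rule integral_D[where B=1]) auto
  also have "\<dots> = integral {0..1} (\<lambda>x. if x \<in> {\<theta>..1} then f x else 0)"
    by (intro integral_cong) auto
  also have "\<dots> = integral {\<theta>..1} f"
    using assms f_integrable[of \<theta> 1]
    by (intro integral_unique, subst has_integral_restrict) (auto intro: integrable_integral)
  also have "\<dots> = 1 - F \<theta>" using F_diff[of \<theta> 1] assms by simp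
  finally show ?thesis .
qed

text \<open>The count is written as a sum of indicators so that linearity of expectation and
  Hoeffding's inequality apply directly.\<close>

definition acceptors :: "nat \<Rightarrow> real \<Rightarrow> (nat \<Rightarrow> real) \<Rightarrow> real" where
  "acceptors n \<theta> v = (\<Sum>i<n. if \<theta> \<le> v i then 1 else 0)"

lemma acceptors_eq_card: "acceptors n \<theta> v = real (card {i\<in>{..<n}. \<theta> \<le> v i})"
  by (simp add: acceptors_def sum.If_cases Int_def)

lemma measurable_accept [measurable]:
  "i < n \<Longrightarrow> (\<lambda>v. if \<theta> \<le> v i then 1 else 0::real) \<in> borel_measurable (valuation_law f n)"
proof -
  assume "i < n"
  then have [measurable]: "(\<lambda>v. v i) \<in> borel_measurable (valuation_law f n)"
    by (simp add: measurable_valuation_law measurable_coordinate)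
  show ?thesis by measurable
qed

lemma expectation_accept:
  assumes "\<theta> \<in> {0..1}" "i < n"
  shows "(\<integral>v. (if \<theta> \<le> v i then 1 else 0) \<partial>valuation_law f n) = 1 - F \<theta>"
proof -
  have "D = distr (valuation_law f n) D (\<lambda>v. v i)"
    unfolding valuation_law_eq using assms by (subst distr_PiM_component) (auto intro: prob_space_D)
  then have "1 - F \<theta> = (\<integral>x. (if \<theta> \<le> x then 1 else 0) \<partial>distr (valuation_law f n) D (\<lambda>v. v i))"
    using integral_tail[OF assms(1)] by simp
  also have "\<dots> = (\<integral>v. (if \<theta> \<le> v i then 1 else 0) \<partial>valuation_law f n)"
    using assms by (intro integral_distr) (auto simp: valuation_law_eq)
  finally show ?thesis by simp
qed

text \<open>The joint law of the coordinates is the product measure itself, which is the product of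
  their marginals; independence passes to functions of single coordinates.\<close>

lemma indep_accept:
  assumes n: "n > 0"
  shows "prob_space.indep_vars (valuation_law f n) (\<lambda>_. borel)
     (\<lambda>i v. if \<theta> \<le> v i then 1 else 0 :: real) {..<n}"
proof -
  interpret P: prob_space "valuation_law f n" by (rule prob_space_valuation_law)
  have comp: "(\<lambda>v. v i) \<in> measurable (valuation_law f n) D" if "i \<in> {..<n}" for i
    using that unfolding valuation_law_eq by (rule measurable_component_singleton)
  have "distr (valuation_law f n) (\<Pi>\<^sub>M i\<in>{..<n}. D) (\<lambda>v. \<lambda>i\<in>{..<n}. v i) =
      distr (valuation_law f n) (valuation_law f n) (\<lambda>v. v)"
    unfolding valuation_law_eq by (intro distr_cong) (auto simp: space_PiM PiE_def extensional_restrict)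
  also have "\<dots> = (\<Pi>\<^sub>M i\<in>{..<n}. D)" by (simp add: valuation_law_eq)
  also have "\<dots> = (\<Pi>\<^sub>M i\<in>{..<n}. distr (valuation_law f n) D (\<lambda>v. v i))"
    unfolding valuation_law_eq
    by (intro PiM_cong refl) (simp add: distr_PiM_component[where M="\<lambda>_. D"] prob_space_D)
  finally have "P.indep_vars (\<lambda>_. D) (\<lambda>i v. v i) {..<n}"
    using n comp by (subst P.indep_vars_iff_distr_eq_PiM') auto
  then show ?thesis
    by (rule P.indep_vars_compose2) measurable
qed

lemma expectation_acceptors:
  assumes "\<theta> \<in> {0..1}"
  shows "(\<integral>v. acceptors n \<theta> v \<partial>valuation_law f n) = real n * (1 - F \<theta>)"
    and "integrable (valuation_law f n) (acceptors n \<theta>)"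
proof -
  interpret P: prob_space "valuation_law f n" by (rule prob_space_valuation_law)
  have int: "integrable (valuation_law f n) (\<lambda>v. if \<theta> \<le> v i then 1 else 0 :: real)" if "i \<in> {..<n}" for i
    using that by (intro P.integrable_const_bound[where B=1]) auto
  show "(\<integral>v. acceptors n \<theta> v \<partial>valuation_law f n) = real n * (1 - F \<theta>)"
    using int expectation_accept[OF assms] unfolding acceptors_def
    by (subst Bochner_Integration.integral_sum) auto
  show "integrable (valuation_law f n) (acceptors n \<theta>)"
    unfolding acceptors_def[abs_def] using int by auto
qed

lemma prob_few_acceptors:
  assumes "\<theta> \<in> {0..1}" "n > 0" "\<epsilon> \<ge> 0"
  shows "measure (valuation_law f n) {v \<in> space (valuation_law f n). acceptors n \<theta> v \<le> real n * (1 - F \<theta>) - \<epsilon>}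
     \<le> exp (- 2 * \<epsilon>\<^sup>2 / real n)"
proof -
  interpret P: prob_space "valuation_law f n" by (rule prob_space_valuation_law)
  interpret H: Hoeffding_ineq "valuation_law f n" "{..<n}" "\<lambda>i v. if \<theta> \<le> v i then 1 else 0"
    "\<lambda>_. 0" "\<lambda>_. 1" "\<Sum>i<n. P.expectation (\<lambda>v. if \<theta> \<le> v i then 1 else 0)"
    using assms(2) by unfold_locales (auto intro: indep_accept)
  show ?thesis
    using H.Hoeffding_ineq_le[of \<epsilon>] assms expectation_accept[OF assms(1)]
    by (simp add: acceptors_def)
qed

lemma expected_sum_delay_single_deadline_le:
  assumes \<theta>: "\<theta> \<in> {0<..<1}" and n: "n > 0"
    and a: "a \<ge> 1" "\<theta> * a \<ge> 1" "a + 1 \<le> real n * (1 - F \<theta>)"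
  shows "expected_sum_delay f n (single_deadline n (1 / (\<theta> * a)))
    \<le> real n * F \<theta> / (\<theta> * a) + real n * exp (- 2 * (real n * (1 - F \<theta>) - (a + 1))\<^sup>2 / real n)"
proof -
  interpret P: prob_space "valuation_law f n" by (rule prob_space_valuation_law)
  define d where "d = 1 / (\<theta> * a)"
  have d: "d \<in> {0..1}" "d * \<theta> * a = 1" using \<theta> a by (auto simp: d_def)
  have \<theta>': "\<theta> \<in> {0..1}" using \<theta> by auto
  define Bad where "Bad = {v \<in> space (valuation_law f n). acceptors n \<theta> v \<le> a + 1}"
  note acc = expectation_acceptors[OF \<theta>']
  have "acceptors n \<theta> \<in> borel_measurable (valuation_law f n)" using acc(2) by (rule borel_measurable_integrable)
  then have Bad: "Bad \<in> sets (valuation_law f n)" unfolding Bad_def by measurable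
  have rel01: "release (single_deadline n d) v i \<in> {0..1}" for v i
    using d by (auto simp: single_deadline_def)
  \<comment> \<open>The linear bound is nonnegative everywhere, so it is kept on \<open>Bad\<close>
    too and its expectation is computed exactly. On \<open>Bad\<close> the trivial bound
    \<open>n\<close> is added.\<close>
  have "expected_sum_delay f n (single_deadline n d) \<le>
      (\<integral>v. d * (real n - acceptors n \<theta> v) + real n * indicator Bad v \<partial>valuation_law f n)"
    unfolding expected_sum_delay_def
  proof (rule integral_mono')
    show "integrable (valuation_law f n) (\<lambda>v. d * (real n - acceptors n \<theta> v) + real n * indicator Bad v)"
      using acc(2) Bad by (intro Bochner_Integration.integrable_add integrable_mult_right Bochner_Integration.integrable_diff)
        (auto simp: P.emeasure_eq_measure)
  next
    fix v assume v: "v \<in> space (valuation_law f n)"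
    have "card {i\<in>{..<n}. \<theta> \<le> v i} \<le> card {..<n}" by (intro card_mono) auto
    then have nonneg: "0 \<le> d * (real n - acceptors n \<theta> v)" using d by (simp add: acceptors_eq_card)
    show "0 \<le> d * (real n - acceptors n \<theta> v) + real n * indicator Bad v" using nonneg by simp
    show "(\<Sum>i<n. release (single_deadline n d) v i) \<le> d * (real n - acceptors n \<theta> v) + real n * indicator Bad v"
    proof (cases "v \<in> Bad")
      case True
      have "(\<Sum>i<n. release (single_deadline n d) v i) \<le> (\<Sum>i<n. 1)"
        using rel01 by (intro sum_mono) auto
      with True nonneg show ?thesis by simp
    next
      case False
      then have "real (card {i\<in>{..<n}. \<theta> \<le> v i}) \<ge> a + 1" using v by (simp add: Bad_def acceptors_eq_card)
      from sum_release_single_deadline_le[OF d(1) this a(1)] d(2) False show ?thesis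
        by (simp add: acceptors_eq_card)
    qed
  qed
  also have "\<dots> = d * (real n - real n * (1 - F \<theta>)) + real n * measure (valuation_law f n) Bad"
    using acc Bad by (simp add: P.prob_space P.emeasure_eq_measure)
  also have "\<dots> \<le> d * (real n - real n * (1 - F \<theta>)) + real n * exp (- 2 * (real n * (1 - F \<theta>) - (a + 1))\<^sup>2 / real n)"
    using prob_few_acceptors[OF \<theta>' n, of "real n * (1 - F \<theta>) - (a + 1)"] a
    by (intro add_left_mono mult_left_mono) (auto simp: Bad_def)
  also have "d * (real n - real n * (1 - F \<theta>)) = real n * F \<theta> / (\<theta> * a)"
    by (simp add: d_def algebra_simps)
  finally show ?thesis by (simp add: d_def)
qed

section \<open>Lower bound for arbitrary mechanisms\<close>

lemma delay_payment_bound: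
  assumes m: "is_mechanism n m" "strategy_proof n m" "individually_rational n m" and i: "i < n"
    and h: "\<And>t. t \<in> {0..1} \<Longrightarrow> h * (t * (1 - F t)) \<le> F t" and h0: "0 \<le> h"
  shows "integrable (valuation_law f n) (\<lambda>v. release m v i)"
    and "integrable (valuation_law f n) (\<lambda>v. payment m v i)"
    and "h * (\<integral>v. payment m v i \<partial>valuation_law f n) \<le> (\<integral>v. release m v i \<partial>valuation_law f n)"
proof -
  interpret P: prob_space "valuation_law f n" by (rule prob_space_valuation_law)
  interpret prod: product_prob_space "\<lambda>_. D" "{..<n}" by unfold_locales
  have rel: "release m v i \<in> {0..1}" and pay0: "payment m v i \<ge> 0" if "v \<in> profiles n" for v
    using m(1) i that by (auto simp: is_mechanism_def)
  \<comment> \<open>Individual rationality caps the payment by the valuation, which makes it bounded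
    and hence integrable.\<close>
  have pay1: "payment m v i \<le> 1" if v: "v \<in> profiles n" for v
  proof -
    have "payment m v i \<le> v i * (1 - release m v i)"
      using m(3) v i by (auto simp: individually_rational_def utility_def)
    also have "\<dots> \<le> 1 * 1"
      using v i rel[OF v] by (intro mult_mono) (auto simp: profiles_def PiE_iff)
    finally show ?thesis by simp
  qed
  have meas: "(\<lambda>v. release m v i) \<in> borel_measurable (valuation_law f n)"
    "(\<lambda>v. payment m v i) \<in> borel_measurable (valuation_law f n)"
    using m(1) i by (auto simp: is_mechanism_def measurable_valuation_law)
  show int: "integrable (valuation_law f n) (\<lambda>v. release m v i)"
    "integrable (valuation_law f n) (\<lambda>v. payment m v i)"
    using rel pay0 pay1 meas
    by (auto intro!: P.integrable_const_bound[where B=1] AE_I2 simp: space_valuation_law)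
  define g where "g v = release m v i - h * payment m v i" for v
  have int_g: "integrable (valuation_law f n) g"
    unfolding g_def[abs_def] using int by auto
  let ?J = "{..<n} - {i}"
  have J: "insert i ?J = {..<n}" using i by auto
  \<comment> \<open>By Fubini it suffices to integrate over the agent's own valuation
    \<open>y\<close> while the others' reports \<open>w\<close> are fixed; there
    \<open>monopoly_bound\<close> applies.\<close>
  have "0 \<le> (\<integral>w. (\<integral>y. g (w(i := y)) \<partial>D) \<partial>Pi\<^sub>M ?J (\<lambda>_. D))"
  proof (rule Bochner_Integration.integral_nonneg)
    fix w assume w: "w \<in> space (Pi\<^sub>M ?J (\<lambda>_. D))"
    have prof: "w(i := y) \<in> profiles n" if "y \<in> {0..1}" for y
      using w that i by (auto simp: profiles_def space_PiM PiE_iff extensional_def)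
    have "(\<lambda>y. w(i := y)) \<in> measurable D (valuation_law f n)"
      unfolding valuation_law_eq using measurable_component_update[OF w, of i] unfolding J by simp
    then have meas_g: "(\<lambda>y. g (w(i := y))) \<in> borel_measurable D"
      using borel_measurable_integrable[OF int_g] by (rule measurable_compose)
    define x where "x y = 1 - release m (w(i := y)) i" for y
    define p where "p y = payment m (w(i := y)) i" for y
    have x01: "0 \<le> x z \<and> x z \<le> 1" if "z \<in> {0..1}" for z
      using rel[OF prof[OF that]] by (simp add: x_def)
    have p0: "0 \<le> p z" if "z \<in> {0..1}" for z using pay0[OF prof[OF that]] by (simp add: p_def)
    have sp: "z * x w' - p w' \<le> z * x z - p z" if "z \<in> {0..1}" "w' \<in> {0..1}" for z w'
      using m(2) i prof[OF that(1)] that(2)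
      by (force simp: strategy_proof_def utility_def x_def p_def)
    have ir: "p 0 \<le> 0"
      using m(3) i prof[of 0] by (force simp: individually_rational_def utility_def p_def)
    note M = monopoly_bound[of x p, OF x01 p0 sp ir h h0]
    have bnd: "\<bar>g (w(i := y))\<bar> \<le> 1 + h" if "y \<in> {0..1}" for y
    proof -
      have "h * payment m (w(i := y)) i \<le> h * 1" "0 \<le> h * payment m (w(i := y)) i"
        using pay0[OF prof[OF that]] pay1[OF prof[OF that]] h0
        by (intro mult_left_mono mult_nonneg_nonneg; simp)+
      then show ?thesis using rel[OF prof[OF that]] h0 by (auto simp: g_def)
    qed
    have "(\<integral>y. g (w(i := y)) \<partial>D) = integral {0..1} (\<lambda>y. f y * g (w(i := y)))"
      using meas_g bnd by (rule integral_D)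
    also have "\<dots> = integral {0..1} (\<lambda>y. f y * (1 - x y) - h * (f y * p y))"
      by (simp add: g_def x_def p_def algebra_simps)
    also have "\<dots> = integral {0..1} (\<lambda>y. f y * (1 - x y)) - h * integral {0..1} (\<lambda>y. f y * p y)"
      using M by (subst Henstock_Kurzweil_Integration.integral_diff) (auto intro: integrable_on_mult_right)
    also have "\<dots> \<ge> 0" using M by simp
    finally show "0 \<le> (\<integral>y. g (w(i := y)) \<partial>D)" .
  qed
  also have "\<dots> = integral\<^sup>L (valuation_law f n) g"
    using prod.product_integral_insert[of ?J i g] int_g unfolding J valuation_law_eq by simp
  also have "\<dots> = (\<integral>v. release m v i \<partial>valuation_law f n) - h * (\<integral>v. payment m v i \<partial>valuation_law f n)"
    unfolding g_def[abs_def] using int by simp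
  finally show "h * (\<integral>v. payment m v i \<partial>valuation_law f n) \<le> (\<integral>v. release m v i \<partial>valuation_law f n)"
    by simp
qed

lemma expected_sum_delay_ge:
  assumes m: "is_mechanism n m" "strategy_proof n m" "individually_rational n m" "ex_post_budget_balanced n m"
    and h: "\<And>t. t \<in> {0..1} \<Longrightarrow> h * (t * (1 - F t)) \<le> F t" and h0: "0 \<le> h" and n: "n > 0"
  shows "real n * h / (real n + h) \<le> expected_sum_delay f n m"
proof -
  interpret P: prob_space "valuation_law f n" by (rule prob_space_valuation_law)
  note bound = delay_payment_bound[OF m(1-3) _ h h0]
  define q where "q = P.expectation (\<lambda>v. of_bool (built m v) :: real)"
  have delay: "expected_sum_delay f n m = (\<Sum>i<n. P.expectation (\<lambda>v. release m v i))"
    unfolding expected_sum_delay_def using bound(1) by (intro Bochner_Integration.integral_sum) auto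
  have "q = P.expectation (\<lambda>v. \<Sum>i<n. payment m v i)"
    unfolding q_def using m(4)
    by (intro Bochner_Integration.integral_cong)
       (auto simp: space_valuation_law ex_post_budget_balanced_def split: if_splits)
  also have "\<dots> = (\<Sum>i<n. P.expectation (\<lambda>v. payment m v i))"
    using bound(2) by (intro Bochner_Integration.integral_sum) auto
  finally have "h * q = (\<Sum>i<n. h * P.expectation (\<lambda>v. payment m v i))"
    by (simp add: sum_distrib_left)
  also have "\<dots> \<le> expected_sum_delay f n m"
    unfolding delay using bound(3) by (intro sum_mono) auto
  finally have 1: "h * q \<le> expected_sum_delay f n m" .
  have [measurable]: "Measurable.pred (valuation_law f n) (built m)"
    using m(1) by (simp add: is_mechanism_def measurable_valuation_law)
  have int: "integrable (valuation_law f n) (\<lambda>v. of_bool (built m v) :: real)"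
    by (intro P.integrable_const_bound[where B=1]) auto
  have "real n * (1 - q) = P.expectation (\<lambda>v. real n * (1 - of_bool (built m v)))"
    unfolding q_def using int by (simp add: P.prob_space)
  also have "\<dots> \<le> expected_sum_delay f n m"
    unfolding expected_sum_delay_def
  proof (rule integral_mono)
    show "integrable (valuation_law f n) (\<lambda>v. \<Sum>i<n. release m v i)" using bound(1) by auto
    show "real n * (1 - of_bool (built m v)) \<le> (\<Sum>i<n. release m v i)"
      if "v \<in> space (valuation_law f n)" for v
    proof (cases "built m v")
      case True
      then show ?thesis using m(1) that
        by (auto simp: is_mechanism_def space_valuation_law intro!: sum_nonneg)
    next
      case False
      then show ?thesis using m(4) that by (auto simp: ex_post_budget_balanced_def space_valuation_law)
    qed
  qed (use int in auto)
  finally have "real n * (1 - q) \<le> expected_sum_delay f n m" .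
  \<comment> \<open>The delay is at least both \<open>h * q\<close> and \<open>n * (1 - q)\<close>; average them with weights \<open>n\<close> and \<open>h\<close>.\<close>
  then have "h * (real n * (1 - q)) + real n * (h * q) \<le>
      h * expected_sum_delay f n m + real n * expected_sum_delay f n m"
    using 1 h0 by (intro add_mono mult_left_mono) auto
  then show ?thesis using n h0 by (simp add: field_simps)
qed

text \<open>
  The common limit of \<open>OPT f\<close> and \<open>SD f\<close>: the least expected delay per unit of expected payment
  when an agent is offered a posted price.
\<close>

definition best_ratio :: real where
  "best_ratio = (INF t\<in>{0<..<1}. F t / (t * (1 - F t)))"

lemma price_ratio_pos: "t \<in> {0<..<1} \<Longrightarrow> 0 < t * (1 - F t) \<and> 0 < F t"
  using F_strict_mono[of 0 t] F_strict_mono[of t 1] by auto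

lemma best_ratio_bdd: "bdd_below ((\<lambda>t. F t / (t * (1 - F t))) ` {0<..<1})"
  using price_ratio_pos by (intro bdd_belowI2[where m=0]) (auto intro: less_imp_le divide_nonneg_pos)

lemma best_ratio_nonneg: "0 \<le> best_ratio"
  unfolding best_ratio_def using price_ratio_pos
  by (intro cINF_greatest) (auto intro: less_imp_le divide_nonneg_pos)

text \<open>Without the denominator the bound extends to the endpoints, where
  \<open>t * (1 - F t)\<close> vanishes, and so takes the form required of \<open>h\<close>
  above.\<close>

lemma best_ratio_le: assumes "t \<in> {0..1}" shows "best_ratio * (t * (1 - F t)) \<le> F t"
proof (cases "t \<in> {0<..<1}")
  case True
  then have "best_ratio \<le> F t / (t * (1 - F t))"
    unfolding best_ratio_def by (intro cINF_lower best_ratio_bdd)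
  then show ?thesis using price_ratio_pos[OF True] by (simp add: pos_le_divide_eq)
next
  case False
  with assms have "t = 0 \<or> t = 1" by auto
  then show ?thesis by auto
qed

section \<open>Asymptotics of the two optima\<close>

lemma SD_eventually_less:
  assumes "best_ratio < c"
  shows "eventually (\<lambda>n. SD f n < c) sequentially"
proof -
  obtain \<theta> where \<theta>: "\<theta> \<in> {0<..<1}" "F \<theta> / (\<theta> * (1 - F \<theta>)) < c"
    using assms best_ratio_bdd by (auto simp: best_ratio_def cINF_less_iff)
  define p where "p = 1 - F \<theta>"
  have p: "0 < p" "0 < \<theta>" using price_ratio_pos[OF \<theta>(1)] \<theta>(1) by (auto simp: p_def zero_less_mult_iff)
  \<comment> \<open>By continuity the ratio stays below \<open>c\<close> for some \<open>s\<close>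
    strictly less than \<open>p\<close>. The gap \<delta> between \<open>p\<close> and
    \<open>s\<close> gives a margin linear in \<open>n\<close> for the concentration bound.\<close>
  have "((\<lambda>s. F \<theta> / (\<theta> * s)) \<longlongrightarrow> F \<theta> / (\<theta> * p)) (at_left p)"
    using p by (intro tendsto_intros) auto
  then have "eventually (\<lambda>s. F \<theta> / (\<theta> * s) < c) (at_left p)"
    using \<theta>(2) by (intro order_tendstoD) (auto simp: p_def)
  moreover have "eventually (\<lambda>s. s \<in> {0<..<p}) (at_left p)" using p(1) by (rule eventually_at_left_real)
  ultimately have "eventually (\<lambda>s. F \<theta> / (\<theta> * s) < c \<and> s \<in> {0<..<p}) (at_left p)"
    by (rule eventually_conj)
  then obtain s where s: "F \<theta> / (\<theta> * s) < c" "0 < s" "s < p"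
    using eventually_happens'[OF trivial_limit_at_left_real] by auto
  define \<delta> where "\<delta> = p - s"
  have \<delta>: "0 < \<delta>" using s by (simp add: \<delta>_def)
  \<comment> \<open>This is the bound of \<open>expected_sum_delay_single_deadline_le\<close> for
    \<open>a = real n * s\<close>: the factor \<open>n\<close> cancels in the first term, and
    \<open>real n * \<delta> - 1\<close> is the deviation from the mean.\<close>
  define B where "B n = F \<theta> / (\<theta> * s) + real n * exp (- 2 * (real n * \<delta> - 1)\<^sup>2 / real n)" for n
  have "(\<lambda>n::nat. real n * exp (- 2 * (real n * \<delta> - 1)\<^sup>2 / real n)) \<longlonglongrightarrow> 0"
    using \<delta> by real_asymp
  then have "B \<longlonglongrightarrow> F \<theta> / (\<theta> * s) + 0"
    unfolding B_def[abs_def] by (intro tendsto_intros)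
  then have ev1: "eventually (\<lambda>n. B n < c) sequentially"
    using s(1) by (intro order_tendstoD) auto
  have ev2: "eventually (\<lambda>n. real n * s \<ge> 1) sequentially"
    "eventually (\<lambda>n. \<theta> * (real n * s) \<ge> 1) sequentially"
    "eventually (\<lambda>n. 1 \<le> real n * \<delta>) sequentially"
    using s p \<delta> by real_asymp+
  show ?thesis
    using ev1 ev2 eventually_gt_at_top[of 0]
  proof eventually_elim
    case (elim n)
    have d: "1 / (\<theta> * (real n * s)) \<in> {0..1}" using elim p s by auto
    have "SD f n \<le> expected_sum_delay f n (single_deadline n (1 / (\<theta> * (real n * s))))"
      unfolding SD_def
    proof (rule cINF_lower[OF _ d])
      show "bdd_below ((\<lambda>d. expected_sum_delay f n (single_deadline n d)) ` {0..1})"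
        by (intro bdd_belowI2[where m=0])
           (auto simp: expected_sum_delay_def single_deadline_def intro!: Bochner_Integration.integral_nonneg sum_nonneg)
    qed
    also have "\<dots> \<le> real n * F \<theta> / (\<theta> * (real n * s)) +
        real n * exp (- 2 * (real n * (1 - F \<theta>) - (real n * s + 1))\<^sup>2 / real n)"
      using elim \<theta>(1) by (intro expected_sum_delay_single_deadline_le) (auto simp: \<delta>_def p_def algebra_simps)
    also have "\<dots> = B n"
      using elim by (simp add: B_def \<delta>_def p_def algebra_simps)
    finally show ?case using elim by simp
  qed
qed

lemma OPT_le_SD: "OPT f n \<le> SD f n"
  unfolding SD_def
proof (rule cINF_greatest)
  fix d :: real assume d: "d \<in> {0..1}"
  show "OPT f n \<le> expected_sum_delay f n (single_deadline n d)"
    unfolding OPT_def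
  proof (rule cINF_lower)
    show "bdd_below (expected_sum_delay f n ` {m. is_mechanism n m \<and> strategy_proof n m \<and>
        individually_rational n m \<and> ex_post_budget_balanced n m})"
      by (intro bdd_belowI2[where m=0])
         (auto simp: expected_sum_delay_def space_valuation_law is_mechanism_def
           intro!: Bochner_Integration.integral_nonneg sum_nonneg)
  qed (use d in \<open>auto intro: is_mechanism_single_deadline strategy_proof_single_deadline
    individually_rational_single_deadline ex_post_budget_balanced_single_deadline\<close>)
qed auto

lemma OPT_ge:
  assumes "n > 0" shows "real n * best_ratio / (real n + best_ratio) \<le> OPT f n"
  unfolding OPT_def
proof (rule cINF_greatest)
  \<comment> \<open>A lower bound passes to the real infimum only over a nonempty set; the mechanism
    with deadline 1 is a member.\<close>
  show "{m. is_mechanism n m \<and> strategy_proof n m \<and> individually_rational n m \<and>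
      ex_post_budget_balanced n m} \<noteq> {}"
    using is_mechanism_single_deadline[of 1 n] strategy_proof_single_deadline[of 1 n]
      individually_rational_single_deadline[of 1 n] ex_post_budget_balanced_single_deadline[of 1 n] by auto
qed (use assms best_ratio_le best_ratio_nonneg in \<open>auto intro!: expected_sum_delay_ge\<close>)

lemma SD_minus_OPT_tendsto_0: "(\<lambda>n. SD f n - OPT f n) \<longlonglongrightarrow> 0"
proof (rule order_tendstoI)
  fix c :: real assume "c < 0"
  then show "eventually (\<lambda>n. c < SD f n - OPT f n) sequentially"
    using OPT_le_SD by (intro always_eventually allI) (smt (verit))
next
  fix c :: real assume c: "0 < c"
  \<comment> \<open>Only \<open>best_ratio >= 0\<close> is known; when it is 0 the sequence is
    constantly 0, which is handled separately.\<close>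
  have *: "(\<lambda>n. real n * b / (real n + b)) \<longlonglongrightarrow> b" if "b > 0" for b
    using that by real_asymp
  have "(\<lambda>n. real n * best_ratio / (real n + best_ratio)) \<longlonglongrightarrow> best_ratio"
  proof (cases "best_ratio = 0")
    case False
    with best_ratio_nonneg show ?thesis by (intro *) simp
  qed simp
  then have "eventually (\<lambda>n. best_ratio - c / 2 < real n * best_ratio / (real n + best_ratio)) sequentially"
    using c by (intro order_tendstoD) auto
  moreover have "eventually (\<lambda>n. SD f n < best_ratio + c / 2) sequentially"
    using c by (intro SD_eventually_less) auto
  ultimately show "eventually (\<lambda>n. SD f n - OPT f n < c) sequentially"
    using eventually_gt_at_top[of 0]
  proof eventually_elim
    case (elim n)
    then show ?case using OPT_ge[of n] by simp
  qed
qed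

end

theorem theorem4p2:
  fixes f :: "real \<Rightarrow> real" and L :: real
  assumes density_pos: "\<And>x. x \<in> {0..1} \<Longrightarrow> f x > 0"
    and density_lipschitz: "L-lipschitz_on {0..1} f"
    and density_total: "(f has_integral 1) {0..1}"
  shows "(\<lambda>n. SD f n - OPT f n) \<longlonglongrightarrow> 0"
proof -
  interpret valuation_density f
    using assms by unfold_locales (auto intro: lipschitz_on_continuous_on)
  show ?thesis by (rule SD_minus_OPT_tendsto_0)
qed

end
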